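(* Let $\ell^*=\min\{f(x)\mid x\in\Delta^c\}$ and $u^*=\max\{f(x)\mid x\in\Delta\}$, and assume $\ell^*<u^*$. Let $\ell,u\in\mathbb{R}$ satisfy $\ell\le\ell^*$ and $u\ge u^*$, let $\epsilon>0$, and put $\rho=u$ and $\sigma=u-\ell+\epsilon$. Then: (1) there is no $x\in\Delta$ with $f(x)>\rho$; (2) for every $x\in\Delta^c$, $f(x)+\sigma\lVert Ax-b\rVert^2>\rho$.
   Context: Let $\hat F\in\mathbb{R}^{n\times n}$ be symmetric, $\hat c\in\mathbb{R}^n$, $\hat A\in\mathbb{Z}^{m\times n}$, $\hat b\in\mathbb{Z}^m$. With $e$ the all-ones vector, let $F=\frac14\hat F$, $c=\frac12(\hat c+\hat Fe)$, $\alpha=\frac12\hat c^\top e+\frac14e^\top\hat Fe$, $A=\frac12\hat A$, $b=\hat b-\frac12\hat Ae$. Set $f(x)=x^\top Fx+c^\top x+\alpha$, $\Delta=\{x\in\{-1,1\}^n\mid Ax=b\}$ and $\Delta^c=\{x\in\{-1,1\}^n\mid Ax\neq b\}$. $\lVert\cdot\rVert$ is the Euclidean norm. Conventions: $\min\emptyset=+\infty$, $\max\emptyset=-\infty$. *)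

theory Defs
  imports "HOL-Analysis.Analysis" "HOL-Library.Extended_Real"
begin

abbreviation ones :: "real ^ 'n" where
  "ones \<equiv> vec 1"

definition real_vec :: "int ^ 'n \<Rightarrow> real ^ 'n" where
  "real_vec v = (\<chi> i. real_of_int (v $ i))"

definition real_mat :: "int ^ 'n ^ 'm \<Rightarrow> real ^ 'n ^ 'm" where
  "real_mat M = (\<chi> i j. real_of_int (M $ i $ j))"

text \<open>The data \<open>Fh\<close>, \<open>ch\<close>, \<open>Ah\<close>, \<open>bh\<close> (the hatted symbols) describe a problem over binary
  vectors \<open>y\<close>. The following quantities are its translation to vectors with entries \<open>-1\<close> and
  \<open>1\<close> under the substitution \<open>y = (x + ones) / 2\<close>.\<close>

definition F_of :: "real ^ 'n ^ 'n \<Rightarrow> real ^ 'n ^ 'n" where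
  "F_of Fh = (1/4) *\<^sub>R Fh"

definition c_of :: "real ^ 'n ^ 'n \<Rightarrow> real ^ 'n \<Rightarrow> real ^ 'n" where
  "c_of Fh ch = (1/2) *\<^sub>R (ch + Fh *v ones)"

definition alpha_of :: "real ^ 'n ^ 'n \<Rightarrow> real ^ 'n \<Rightarrow> real" where
  "alpha_of Fh ch = (1/2) * (ch \<bullet> ones) + (1/4) * (ones \<bullet> (Fh *v ones))"

definition A_of :: "int ^ 'n ^ 'm \<Rightarrow> real ^ 'n ^ 'm" where
  "A_of Ah = (1/2) *\<^sub>R real_mat Ah"

definition b_of :: "int ^ 'n ^ 'm \<Rightarrow> int ^ 'm \<Rightarrow> real ^ 'm" where
  "b_of Ah bh = real_vec bh - (1/2) *\<^sub>R (real_mat Ah *v ones)"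

definition obj :: "real ^ 'n ^ 'n \<Rightarrow> real ^ 'n \<Rightarrow> real ^ 'n \<Rightarrow> real" where
  "obj Fh ch x = x \<bullet> (F_of Fh *v x) + c_of Fh ch \<bullet> x + alpha_of Fh ch"

definition sign_vecs :: "(real ^ 'n) set" where
  "sign_vecs = {x. \<forall>i. x $ i \<in> {-1, 1}}"

definition Delta :: "int ^ 'n ^ 'm \<Rightarrow> int ^ 'm \<Rightarrow> (real ^ 'n) set" where
  "Delta Ah bh = {x \<in> sign_vecs. A_of Ah *v x = b_of Ah bh}"

definition Delta_c :: "int ^ 'n ^ 'm \<Rightarrow> int ^ 'm \<Rightarrow> (real ^ 'n) set" where
  "Delta_c Ah bh = {x \<in> sign_vecs. A_of Ah *v x \<noteq> b_of Ah bh}"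

text \<open>Minimum and maximum over a finite, possibly empty set, extended-real valued.\<close>

definition min_over :: "('a \<Rightarrow> real) \<Rightarrow> 'a set \<Rightarrow> ereal" where
  "min_over g S = (if S = {} then \<infinity> else ereal (Min (g ` S)))"

definition max_over :: "('a \<Rightarrow> real) \<Rightarrow> 'a set \<Rightarrow> ereal" where
  "max_over g S = (if S = {} then -\<infinity> else ereal (Max (g ` S)))"

text \<open>\<open>Min\<close> and \<open>Max\<close> are unspecified on infinite sets; here they are only taken over subsets of
  the finite set \<open>sign_vecs\<close>.\<close>

lemma finite_sign_vecs: "finite (sign_vecs :: (real ^ 'n) set)"
proof (rule finite_subset)
  show "sign_vecs \<subseteq> vec_lambda ` (UNIV \<rightarrow>\<^sub>E {-1, 1 :: real} :: ('n \<Rightarrow> real) set)"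
  proof
    fix x :: "real ^ 'n" assume "x \<in> sign_vecs"
    then have "vec_nth x \<in> UNIV \<rightarrow>\<^sub>E {-1, 1}" by (auto simp: sign_vecs_def PiE_def Pi_def)
    then have "vec_lambda (vec_nth x) \<in> vec_lambda ` (UNIV \<rightarrow>\<^sub>E {-1, 1 :: real})"
      by (rule imageI)
    then show "x \<in> vec_lambda ` (UNIV \<rightarrow>\<^sub>E {-1, 1 :: real})" by simp
  qed
  show "finite (vec_lambda ` (UNIV \<rightarrow>\<^sub>E {-1, 1 :: real} :: ('n \<Rightarrow> real) set))"
    by (intro finite_imageI finite_PiE) auto
qed

end

theory Submission imports Defs begin

text \<open>Under \<open>y = (x + ones) / 2\<close> the residual \<open>A x - b\<close> becomes the integer residual of the
  binary problem, so a sign vector violating the constraints has squared residual at least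
  \<open>1\<close>. The penalty then adds at least \<open>\<sigma> = u - l + \<epsilon>\<close> to an objective value
  that is at least \<open>l\<close>.\<close>

text \<open>The term \<open>(1/2) *\<^sub>R (real_mat Ah *v ones)\<close> subtracted in
  \<open>b_of\<close> returns with a plus sign and joins the halved matrix of \<open>A_of\<close>,
  so each entry of \<open>Ah\<close> is multiplied by \<open>(x $ j + 1) / 2\<close>.\<close>

lemma residual_eq_binary_residual:
  "(A_of Ah *v x - b_of Ah bh) $ i =
    (\<Sum>j\<in>UNIV. real_of_int (Ah $ i $ j) * ((x $ j + 1) / 2)) - real_of_int (bh $ i)"
  by (simp add: A_of_def b_of_def real_mat_def real_vec_def matrix_vector_mult_def
      sum_distrib_left sum.distrib algebra_simps add_divide_distrib flip: sum_divide_distrib)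

lemma residual_in_Ints:
  assumes "x \<in> sign_vecs"
  shows "(A_of Ah *v x - b_of Ah bh) $ i \<in> \<int>"
proof -
  \<comment> \<open>The entries -1 and 1 go to 0 and 1. Integrality of \<open>x\<close> alone would
    not survive the halving.\<close>
  have "(x $ j + 1) / 2 \<in> \<int>" for j
  proof -
    have "x $ j = -1 \<or> x $ j = 1"
      using assms by (auto simp: sign_vecs_def)
    then show ?thesis by auto
  qed
  then show ?thesis
    unfolding residual_eq_binary_residual by (intro Ints_diff Ints_sum Ints_mult Ints_of_int)
qed

lemma norm_ge_1_if_Ints_vec:
  fixes v :: "real ^ 'n"
  assumes "\<And>i. v $ i \<in> \<int>" and "v \<noteq> 0"
  shows "1 \<le> norm v"
proof -
  obtain i where "v $ i \<noteq> 0"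
    using \<open>v \<noteq> 0\<close> by (auto simp: vec_eq_iff)
  then have "1 \<le> \<bar>v $ i\<bar>"
    using assms(1) Ints_nonzero_abs_ge1 by blast
  also have "\<dots> \<le> norm v"
    by (rule component_le_norm_cart)
  finally show ?thesis .
qed

lemma min_over_le:
  assumes "finite S" and "x \<in> S"
  shows "min_over g S \<le> ereal (g x)"
  using assms by (auto simp: min_over_def)

lemma max_over_ge:
  assumes "finite S" and "x \<in> S"
  shows "ereal (g x) \<le> max_over g S"
  using assms by (auto simp: max_over_def)

lemma finite_Delta: "finite (Delta Ah bh)"
  by (rule finite_subset[OF _ finite_sign_vecs]) (auto simp: Delta_def)

lemma finite_Delta_c: "finite (Delta_c Ah bh)"
  by (rule finite_subset[OF _ finite_sign_vecs]) (auto simp: Delta_c_def)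

theorem proposition8:
  fixes Fh :: "real ^ 'n ^ 'n" and ch :: "real ^ 'n"
    and Ah :: "int ^ 'n ^ 'm" and bh :: "int ^ 'm"
    and lstar ustar :: ereal
    and l u \<epsilon> \<rho> \<sigma> :: real
  assumes "transpose Fh = Fh"
    and "lstar = min_over (obj Fh ch) (Delta_c Ah bh)"
    and "ustar = max_over (obj Fh ch) (Delta Ah bh)"
    and "lstar < ustar"
    and "ereal l \<le> lstar" and "ustar \<le> ereal u"
    and "\<epsilon> > 0"
    and "\<rho> = u" and "\<sigma> = u - l + \<epsilon>"
  shows "(\<not> (\<exists>x \<in> Delta Ah bh. obj Fh ch x > \<rho>)) \<and>
    (\<forall>x \<in> Delta_c Ah bh.
      obj Fh ch x + \<sigma> * (norm (A_of Ah *v x - b_of Ah bh))\<^sup>2 > \<rho>)"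
proof (intro conjI ballI)
  have "ereal (obj Fh ch x) \<le> ereal u" if "x \<in> Delta Ah bh" for x
    using max_over_ge[OF finite_Delta that] assms(3,6) order_trans by blast
  then show "\<not> (\<exists>x \<in> Delta Ah bh. obj Fh ch x > \<rho>)"
    using assms(8) by force
next
  fix x :: "real ^ 'n"
  assume x: "x \<in> Delta_c Ah bh"
  let ?r = "A_of Ah *v x - b_of Ah bh"
  \<comment> \<open>The chain \<open>l\<close> \<le> \<open>lstar\<close> < \<open>ustar\<close>
    \<le> \<open>u\<close> is where the gap assumption enters. It makes \<sigma> positive, so that
    the bound on the squared norm can be scaled by \<sigma>.\<close>
  have "ereal l < ereal u"
    using assms(4-6) by (meson le_less_trans less_le_trans)
  then have "\<sigma> > 0"
    using assms(7,9) by simp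
  have "ereal l \<le> ereal (obj Fh ch x)"
    using min_over_le[OF finite_Delta_c x] assms(2,5) order_trans by blast
  moreover have "1 \<le> norm ?r"
    using x by (intro norm_ge_1_if_Ints_vec residual_in_Ints) (auto simp: Delta_c_def)
  then have "\<sigma> * 1 \<le> \<sigma> * (norm ?r)\<^sup>2"
    using \<open>\<sigma> > 0\<close> by (intro mult_left_mono) (auto simp: one_le_power)
  \<comment> \<open>The left side is at least
    \<open>l + (u - l + \<epsilon>) = u + \<epsilon>\<close>; the summand \<epsilon> makes the
    inequality strict.\<close>
  ultimately show "obj Fh ch x + \<sigma> * (norm ?r)\<^sup>2 > \<rho>"
    using assms(7-9) by simp
qed

end
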